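(* For every $n\geq 1$ and every $\sigma\in\Omega$, the number of permutations in $\mathcal{S}_n$ that avoid the chain $(312,321:\sigma)$ is equal to the number of compositions of $n$ that avoid the set $C(\sigma)$, i.e. that avoid every composition in $C(\sigma)$.
   Context: Permutations: $\mathcal{S}_n$ is the set of permutations of $\{1,\ldots,n\}$ in one-line form. A permutation contains a pattern $\sigma\in\mathcal{S}_k$ if some subsequence of it (not necessarily consecutive) has the same relative order as $\sigma$; otherwise it avoids $\sigma$. A permutation $\pi$ avoids the chain $(312,321:\sigma)$ if $\pi$ avoids both $312$ and $321$ and $\pi^2=\pi\circ\pi$ avoids $\sigma$. Direct sums: for $\sigma\in\mathcal{S}_k$, $\tau\in\mathcal{S}_m$, $\pi=\sigma\oplus\tau\in\mathcal{S}_{k+m}$ is given by $\pi_i=\sigma_i$ for $1\leq i\leq k$ and $\pi_i=\tau_{i-k}+k$ for $k+1\leq i\leq k+m$. Every permutation is uniquely a direct sum of permutations that are not themselves direct sums of smaller (nonempty) permutations. $\Omega_n$ is the set of $\sigma\in\mathcal{S}_n$ such that, in this decomposition $\sigma=\bigoplus_{i=1}^k\tau^{(i)}$, every $\tau^{(i)}$ lies in $\{1\}\cup\{23\ldots m1:m\geq 2\}\cup\{34\ldots m12:m\geq 3\}$ (with $23\ldots m1=21$ for $m=2$ and $34\ldots m12=312$ for $m=3$), and $\Omega=\bigcup_{n\geq1}\Omega_n$. Compositions: a composition of $n$ is a finite sequence of positive integers summing to $n$. A composition $\mathbf{d}=(d_1,\ldots,d_m)$ contains a composition $\mathbf{c}=(c_1,\ldots,c_k)$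 if there are indices $i_1<\cdots<i_k$ with $d_{i_j}\geq c_j$ for all $1\leq j\leq k$; otherwise it avoids $\mathbf{c}$. The set $C(\sigma)$: for an increasing pattern $12\ldots r$ ($r\ge1$), $C(12\ldots r)$ is the set of the $2^{r-1}$ compositions obtained by taking each composition of $r$ and adding $2$ to every part that is at least $3$. For general $\sigma=\bigoplus_{i=1}^k\tau^{(i)}\in\Omega$ (where this is the unique expression of $\sigma$ as a direct sum of permutations $\tau^{(i)}$ that are not themselves direct sums of smaller nonempty permutations), let $\mathbf{c}(\sigma)=(c_1,\ldots,c_k)$ where $c_i=|\tau^{(i)}|$ if $\tau^{(i)}\in\{1\}\cup\{34\ldots m12:m\geq3\}$ and $c_i=|\tau^{(i)}|+1$ if $\tau^{(i)}\in\{23\ldots m1:m\geq2\}$ (here $|\tau|$ is the length of $\tau$). Then $C(\sigma)$ is the set of all compositions obtained from $\mathbf{c}(\sigma)$ by simultaneously replacing each maximal run of consecutive $1$s, of length $r$ say, by any one of the compositions in $C(12\ldots r)$ (independent choices for different runs; since $(1,\ldots,1)\in C(12\ldots r)$, we have $\mathbf{c}(\sigma)\in C(\sigma)$). For example, $C(123)=\{(1,1,1),(1,2),(2,1),(5)\}$ and $C(1243)=\{(1,1,3),(2,3)\}$. *)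

theory Defs
  imports "HOL-Library.Sublist" "HOL-Combinatorics.Multiset_Permutations"
begin

section \<open>Permutations and patterns\<close>

text \<open>Permutations of \<open>{1..n}\<close> are given in one-line form; values are 1-based while list
  positions are 0-based.\<close>

definition perms :: "nat \<Rightarrow> nat list set" where
  "perms n = permutations_of_set {1..n}"

definition perm_comp :: "nat list \<Rightarrow> nat list \<Rightarrow> nat list" where
  "perm_comp \<pi> \<rho> = map (\<lambda>i. \<pi> ! (i - 1)) \<rho>"

definition same_order :: "nat list \<Rightarrow> nat list \<Rightarrow> bool" where
  "same_order xs ys \<longleftrightarrow> length xs = length ys \<and>
     (\<forall>i < length xs. \<forall>j < length xs. xs ! i < xs ! j \<longleftrightarrow> ys ! i < ys ! j)"

definition perm_contains :: "nat list \<Rightarrow> nat list \<Rightarrow> bool" where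
  "perm_contains \<pi> \<sigma> \<longleftrightarrow> (\<exists>xs. subseq xs \<pi> \<and> same_order xs \<sigma>)"

abbreviation perm_avoids :: "nat list \<Rightarrow> nat list \<Rightarrow> bool" where
  "perm_avoids \<pi> \<sigma> \<equiv> \<not> perm_contains \<pi> \<sigma>"

definition avoids_chain_312_321 :: "nat list \<Rightarrow> nat list \<Rightarrow> bool" where
  "avoids_chain_312_321 \<pi> \<sigma> \<longleftrightarrow>
     perm_avoids \<pi> [3, 1, 2] \<and> perm_avoids \<pi> [3, 2, 1] \<and> perm_avoids (perm_comp \<pi> \<pi>) \<sigma>"


section \<open>Direct sums\<close>

definition dsum :: "nat list \<Rightarrow> nat list \<Rightarrow> nat list" (infixr \<open>\<oplus>\<^sub>d\<close> 65) where
  "\<sigma> \<oplus>\<^sub>d \<tau> = \<sigma> @ map (\<lambda>x. x + length \<sigma>) \<tau>"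

definition dsums :: "nat list list \<Rightarrow> nat list" where
  "dsums \<tau>s = foldr dsum \<tau>s []"

definition indecomposable :: "nat list \<Rightarrow> bool" where
  "indecomposable \<tau> \<longleftrightarrow> (\<exists>n\<ge>1. \<tau> \<in> perms n) \<and>
     \<not> (\<exists>k\<ge>1. \<exists>m\<ge>1. \<exists>\<sigma>\<in>perms k. \<exists>\<rho>\<in>perms m. \<tau> = \<sigma> \<oplus>\<^sub>d \<rho>)"

definition decomposition :: "nat list \<Rightarrow> nat list list" where
  "decomposition \<sigma> = (THE \<tau>s. (\<forall>\<tau>\<in>set \<tau>s. indecomposable \<tau>) \<and> \<sigma> = dsums \<tau>s)"

text \<open>The decomposition is well defined.\<close>

lemma perms_iff: "xs \<in> perms n \<longleftrightarrow> set xs = {1..n} \<and> distinct xs"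
  by (auto simp: perms_def permutations_of_set_def)

lemma length_perms: "xs \<in> perms n \<Longrightarrow> length xs = n"
  using distinct_card[of xs] by (auto simp: perms_iff)

lemma perms_append:
  assumes "\<sigma> @ \<rho> \<in> perms n" and "\<sigma> \<in> perms k"
  shows "\<exists>\<tau>\<in>perms (n - k). \<rho> = map (\<lambda>x. x + k) \<tau>"
proof -
  from assms have u: "{1..k} \<union> set \<rho> = {1..n}" and d: "distinct \<rho>" and dj: "{1..k} \<inter> set \<rho> = {}"
    by (auto simp: perms_iff)
  have s: "set \<rho> = {k<..n}"
  proof -
    have "k \<le> n"
      using assms length_perms[OF assms(1)] length_perms[OF assms(2)] by simp
    then have "{1..n} - {1..k} = {k<..n}" by auto
    with u dj show ?thesis by auto
  qed
  have r: "\<rho> = map (\<lambda>x. x + k) (map (\<lambda>x. x - k) \<rho>)"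
    using s by (auto simp: o_def intro!: map_idI[symmetric])
  have "(\<lambda>x. x - k) ` {k<..n} = {1..n - k}"
  proof (rule set_eqI, rule iffI)
    fix y assume "y \<in> {1..n - k}"
    then have "y = (y + k) - k" "y + k \<in> {k<..n}" by auto
    then show "y \<in> (\<lambda>x. x - k) ` {k<..n}" by blast
  qed auto
  moreover have "inj_on (\<lambda>x. x - k) (set \<rho>)"
    using s by (auto intro!: inj_onI)
  ultimately have "map (\<lambda>x. x - k) \<rho> \<in> perms (n - k)"
    using s d by (auto simp: perms_iff distinct_map)
  with r show ?thesis by blast
qed

lemma dsums_Nil [simp]: "dsums [] = []"
  and dsums_Cons [simp]: "dsums (\<tau> # \<tau>s) = \<tau> \<oplus>\<^sub>d dsums \<tau>s"
  by (auto simp: dsums_def)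

lemma dsum_assoc: "(\<rho> \<oplus>\<^sub>d \<sigma>) \<oplus>\<^sub>d \<tau> = \<rho> \<oplus>\<^sub>d \<sigma> \<oplus>\<^sub>d \<tau>"
  by (simp add: dsum_def o_def add.assoc add.commute)

lemma dsums_append: "dsums (\<sigma>s @ \<tau>s) = dsums \<sigma>s \<oplus>\<^sub>d dsums \<tau>s"
  by (induction \<sigma>s) (auto simp: dsum_assoc, simp add: dsum_def)

lemma indecomposable_nonempty: "indecomposable \<tau> \<Longrightarrow> \<tau> \<noteq> []"
  by (auto simp: indecomposable_def perms_iff)

lemma indecomposable_no_prefix:
  assumes "indecomposable \<sigma>" and "indecomposable \<tau>" and "\<sigma> @ \<rho> = \<tau>"
  shows "\<rho> = []"
proof (rule ccontr)
  assume ne: "\<rho> \<noteq> []"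
  from assms(1) obtain k where k: "k \<ge> 1" "\<sigma> \<in> perms k" by (auto simp: indecomposable_def)
  from assms(2) obtain n where n: "\<tau> \<in> perms n" by (auto simp: indecomposable_def)
  from perms_append[OF _ k(2)] n assms(3)
  obtain \<rho>' where r: "\<rho>' \<in> perms (n - k)" "\<rho> = map (\<lambda>x. x + k) \<rho>'" by blast
  have "\<tau> = \<sigma> \<oplus>\<^sub>d \<rho>'"
    using r(2) assms(3) length_perms[OF k(2)] by (auto simp: dsum_def)
  moreover have "n - k \<ge> 1"
    using ne r length_perms[OF r(1)] by (cases "n - k") auto
  ultimately show False
    using assms(2) k r(1) by (auto simp: indecomposable_def)
qed

lemma dsums_unique:
  assumes "\<forall>\<tau>\<in>set \<sigma>s. indecomposable \<tau>" and "\<forall>\<tau>\<in>set \<tau>s. indecomposable \<tau>"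
    and "dsums \<sigma>s = dsums \<tau>s"
  shows "\<sigma>s = \<tau>s"
  using assms
proof (induction \<sigma>s arbitrary: \<tau>s)
  case Nil
  then show ?case
    by (cases \<tau>s) (auto simp: dsum_def dest: indecomposable_nonempty)
next
  case (Cons \<sigma> \<sigma>s)
  then obtain \<tau> \<tau>s' where ts: "\<tau>s = \<tau> # \<tau>s'"
    by (cases \<tau>s) (auto simp: dsum_def dest: indecomposable_nonempty)
  have i: "indecomposable \<sigma>" "indecomposable \<tau>"
    using Cons.prems ts by auto
  have eq: "\<sigma> @ map (\<lambda>x. x + length \<sigma>) (dsums \<sigma>s) = \<tau> @ map (\<lambda>x. x + length \<tau>) (dsums \<tau>s')"
    using Cons.prems(3) ts by (simp add: dsum_def)
  then obtain \<rho> where "\<sigma> @ \<rho> = \<tau> \<or> \<tau> @ \<rho> = \<sigma>"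
    by (metis append_eq_append_conv2)
  then have st: "\<sigma> = \<tau>"
    using indecomposable_no_prefix[of \<sigma> \<tau> \<rho>] indecomposable_no_prefix[of \<tau> \<sigma> \<rho>] i by auto
  with eq have "map (\<lambda>x. x + length \<sigma>) (dsums \<sigma>s) = map (\<lambda>x. x + length \<sigma>) (dsums \<tau>s')" by simp
  then have "dsums \<sigma>s = dsums \<tau>s'"
    by (rule map_injective) (simp add: inj_def)
  then have "\<sigma>s = \<tau>s'"
    using Cons ts by auto
  with st ts show ?case by simp
qed

lemma dsums_exists:
  assumes "\<sigma> \<in> perms n"
  shows "\<exists>\<tau>s. (\<forall>\<tau>\<in>set \<tau>s. indecomposable \<tau>) \<and> \<sigma> = dsums \<tau>s"
  using assms
proof (induction n arbitrary: \<sigma> rule: less_induct)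
  case (less n)
  show ?case
  proof (cases "n = 0 \<or> indecomposable \<sigma>")
    case True
    then show ?thesis
    proof
      assume "n = 0"
      with less.prems have "\<sigma> = dsums []" by (simp add: perms_iff)
      then show ?thesis by (intro exI[of _ "[]"]) simp
    next
      assume "indecomposable \<sigma>"
      then show ?thesis by (intro exI[of _ "[\<sigma>]"]) (simp add: dsum_def)
    qed
  next
    case False
    then have "n \<ge> 1" by simp
    with False less.prems obtain k m \<rho> \<tau>
      where km: "k \<ge> 1" "m \<ge> 1" "\<rho> \<in> perms k" "\<tau> \<in> perms m" "\<sigma> = \<rho> \<oplus>\<^sub>d \<tau>"
      unfolding indecomposable_def by blast
    have "n = k + m"
      using length_perms[OF less.prems] length_perms[OF km(3)] length_perms[OF km(4)] km(5)
      by (simp add: dsum_def)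
    with km less.IH[of k \<rho>] less.IH[of m \<tau>] obtain \<rho>s \<tau>s
      where "\<forall>\<tau>\<in>set \<rho>s. indecomposable \<tau>" "\<rho> = dsums \<rho>s"
        "\<forall>\<tau>\<in>set \<tau>s. indecomposable \<tau>" "\<tau> = dsums \<tau>s" by auto
    with km(5) show ?thesis
      by (intro exI[of _ "\<rho>s @ \<tau>s"]) (auto simp: dsums_append)
  qed
qed

lemma decomposition_eqI:
  assumes "\<forall>\<tau>\<in>set \<tau>s. indecomposable \<tau>"
  shows "decomposition (dsums \<tau>s) = \<tau>s"
  unfolding decomposition_def using assms by (intro the_equality) (auto intro: dsums_unique)

lemma decomposition:
  assumes "\<sigma> \<in> perms n"
  shows "\<forall>\<tau>\<in>set (decomposition \<sigma>). indecomposable \<tau>" and "dsums (decomposition \<sigma>) = \<sigma>"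
  using dsums_exists[OF assms] by (auto simp: decomposition_eqI)


section \<open>The set \<open>\<Omega>\<close>\<close>

definition shift_one :: "nat \<Rightarrow> nat list" where
  "shift_one m = [2..<m + 1] @ [1]"  \<comment> \<open>\<open>2 3 \<dots> m 1\<close>\<close>

definition shift_two :: "nat \<Rightarrow> nat list" where
  "shift_two m = [3..<m + 1] @ [1, 2]"  \<comment> \<open>\<open>3 4 \<dots> m 1 2\<close>\<close>

definition Omega_n :: "nat \<Rightarrow> nat list set" where
  "Omega_n n = {\<sigma> \<in> perms n. set (decomposition \<sigma>) \<subseteq>
     {[1]} \<union> {shift_one m | m. m \<ge> 2} \<union> {shift_two m | m. m \<ge> 3}}"

definition Omega :: "nat list set" where
  "Omega = (\<Union>n\<in>{1..}. Omega_n n)"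


section \<open>Compositions\<close>

definition compositions :: "nat \<Rightarrow> nat list set" where
  "compositions n = {c. (\<forall>x\<in>set c. x > 0) \<and> sum_list c = n}"

definition comp_contains :: "nat list \<Rightarrow> nat list \<Rightarrow> bool" where
  "comp_contains d c \<longleftrightarrow> (\<exists>i. strict_mono_on {..<length c} i \<and>
     (\<forall>j < length c. i j < length d \<and> d ! i j \<ge> c ! j))"

definition comp_avoids_set :: "nat list \<Rightarrow> nat list set \<Rightarrow> bool" where
  "comp_avoids_set d A \<longleftrightarrow> (\<forall>c\<in>A. \<not> comp_contains d c)"


section \<open>The set \<open>C(\<sigma>)\<close>\<close>

definition C_incr :: "nat \<Rightarrow> nat list set" where
  "C_incr r = map (\<lambda>x. if x \<ge> 3 then x + 2 else x) ` compositions r"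

definition part_of :: "nat list \<Rightarrow> nat" where
  "part_of \<tau> = (if \<tau> \<in> {shift_one m | m. m \<ge> 2} then length \<tau> + 1 else length \<tau>)"

definition base_comp :: "nat list \<Rightarrow> nat list" where
  "base_comp \<sigma> = map part_of (decomposition \<sigma>)"

text \<open>In the second equation \<open>1 # takeWhile (\<lambda>y. y = 1) xs\<close> is the maximal run of ones at the
  front; the recursion continues after it, so each maximal run is replaced exactly once and
  independently of the others.\<close>

function replace_runs :: "nat list \<Rightarrow> nat list set" where
  "replace_runs [] = {[]}"
| "replace_runs (x # xs) =
     (if x = 1
      then {a @ b | a b. a \<in> C_incr (length (1 # takeWhile (\<lambda>y. y = 1) xs)) \<and>
                         b \<in> replace_runs (dropWhile (\<lambda>y. y = 1) xs)}
      else {x # b | b. b \<in> replace_runs xs})"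
  by pat_completeness auto
termination
  by (relation "measure length") (auto simp: less_Suc_eq_le length_dropWhile_le)

definition C_set :: "nat list \<Rightarrow> nat list set" where
  "C_set \<sigma> = replace_runs (base_comp \<sigma>)"

text \<open>The general definition agrees with the one for increasing patterns.\<close>

lemma C_set_increasing:
  assumes "r \<ge> 1"
  shows "C_set [1..<r + 1] = C_incr r"
proof -
  have 1: "indecomposable [1]"
  proof -
    have "\<exists>n\<ge>1. [1] \<in> perms n"
      by (rule exI[of _ 1]) (auto simp: perms_iff)
    moreover have False
      if *: "k \<ge> 1" "m \<ge> 1" "\<sigma> \<in> perms k" "\<rho> \<in> perms m" "[1] = \<sigma> \<oplus>\<^sub>d \<rho>" for k m \<sigma> \<rho>
    proof -
      have "length [1::nat] = length (\<sigma> \<oplus>\<^sub>d \<rho>)" using *(5) by metis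
      then have "1 = k + m"
        using length_perms[OF *(3)] length_perms[OF *(4)] by (simp add: dsum_def)
      with *(1,2) show False by simp
    qed
    ultimately show ?thesis unfolding indecomposable_def by blast
  qed
  have sum: "dsums (replicate r [1]) = [1..<r + 1]" for r
  proof (induction r)
    case (Suc r)
    then show ?case
      by (simp add: dsum_def map_Suc_upt upt_conv_Cons del: upt_Suc)
  qed simp
  have "decomposition [1..<r + 1] = replicate r [1]"
    using 1 decomposition_eqI[of "replicate r [1]"] sum[of r] by simp
  moreover have "part_of [1] = 1"
    by (auto simp: part_of_def shift_one_def)
  ultimately have "base_comp [1..<r + 1] = replicate r 1"
    by (simp add: base_comp_def)
  then show ?thesis
    using assms by (cases r) (simp_all add: C_set_def)
qed

end

theory Submission
  imports Defs
begin

text \<open>A permutation avoiding \<open>312\<close> and \<open>321\<close> is a direct sum of blocks \<open>2 3 \<dots> m 1\<close>, and the block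
  lengths form a composition \<open>d\<close> of \<open>n\<close>; this is a bijection (\<open>bij_betw_dsums_shift_one\<close>). Squaring
  acts block by block, and the square of \<open>2 3 \<dots> m 1\<close> is \<open>1\<close>, \<open>12\<close> or \<open>3 4 \<dots> m 1 2\<close>, according to whether \<open>m\<close> is
  1, 2 or larger (\<open>square_dsums_shift_one\<close>). It therefore suffices that, for the permutation
  given by \<open>d\<close>, the square contains \<open>\<sigma>\<close> exactly when \<open>d\<close> contains a member of \<open>C(\<sigma>)\<close>
  (\<open>square_contains_iff\<close>).

  In an occurrence of \<open>\<sigma>\<close> in a direct sum, each summand of the host receives a consecutive, possibly
  empty, group of the indecomposable summands of \<open>\<sigma>\<close> (\<open>perm_contains_dsum_dsums\<close>). A squared
  block of length \<open>m\<close> contains two kinds of patterns: increasing ones, and indecomposable ones that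
  combine large entries with the small entries \<open>1 2\<close> at its end. So a nonempty group is either a
  single summand or a run of \<open>r\<close> summands \<open>1\<close> (\<open>square_block_contains_iff_fits\<close>). The least
  \<open>m\<close> that works is, for a single summand, its part in \<open>c(\<sigma>)\<close>, and for a run, \<open>r\<close> if
  \<open>r \<le> 2\<close> and \<open>r + 2\<close> otherwise. Choosing how the ones are grouped is choosing a member of \<open>C(\<sigma>)\<close>
  (\<open>replace_runs_iff_coarsening\<close>), and placing the groups into distinct blocks of \<open>d\<close> that are long
  enough is an occurrence of that member in \<open>d\<close>.\<close>

section \<open>Direct sums of permutations\<close>

text \<open>An initial segment of a permutation lying entirely below the remaining entries is downward closed
  in \<open>{1..n}\<close>, hence takes exactly the smallest values.\<close>

lemma low_part_perms:
  assumes "\<sigma> @ \<rho> \<in> perms n" and low: "\<And>x y. x \<in> set \<sigma> \<Longrightarrow> y \<in> set \<rho> \<Longrightarrow> x < y"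
  shows "\<sigma> \<in> perms (length \<sigma>)"
proof -
  from assms(1) have u: "set \<sigma> \<union> set \<rho> = {1..n}" and d: "distinct \<sigma>"
    by (auto simp: perms_iff)
  have "\<exists>k. set \<sigma> = {1..k}"
  proof (cases "\<sigma> = []")
    case False
    have "set \<sigma> = {1..Max (set \<sigma>)}"
    proof (intro equalityI subsetI)
      fix x assume "x \<in> set \<sigma>"
      then show "x \<in> {1..Max (set \<sigma>)}" using u by auto
    next
      fix x assume x: "x \<in> {1..Max (set \<sigma>)}"
      have m: "Max (set \<sigma>) \<in> set \<sigma>" using False by simp
      with u have "Max (set \<sigma>) \<le> n" by auto
      with x have "x \<in> set \<sigma> \<union> set \<rho>" unfolding u by auto
      moreover have "x \<notin> set \<rho>" using low[OF m, of x] x by auto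
      ultimately show "x \<in> set \<sigma>" by blast
    qed
    then show ?thesis by blast
  qed (auto intro: exI[of _ 0])
  then obtain k where k: "set \<sigma> = {1..k}" ..
  then have "length \<sigma> = k" using distinct_card[OF d] by simp
  with k d show ?thesis by (simp add: perms_iff)
qed

lemma dsum_split:
  assumes "\<sigma> @ \<rho> \<in> perms n" and "\<And>x y. x \<in> set \<sigma> \<Longrightarrow> y \<in> set \<rho> \<Longrightarrow> x < y"
  obtains \<tau> where "\<sigma> \<in> perms (length \<sigma>)" "\<tau> \<in> perms (n - length \<sigma>)" "\<rho> = map (\<lambda>x. x + length \<sigma>) \<tau>"
    "\<sigma> @ \<rho> = \<sigma> \<oplus>\<^sub>d \<tau>"
proof -
  have low: "\<sigma> \<in> perms (length \<sigma>)" by (rule low_part_perms[OF assms])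
  from perms_append[OF assms(1) this] obtain \<tau> where
    \<tau>: "\<tau> \<in> perms (n - length \<sigma>)" "\<rho> = map (\<lambda>x. x + length \<sigma>) \<tau>" by (elim bexE)
  show thesis
    by (rule that[OF low \<tau>]) (simp only: dsum_def \<tau>(2))
qed

lemma dsum_perms:
  assumes "\<alpha> \<in> perms k" "\<beta> \<in> perms l"
  shows "\<alpha> \<oplus>\<^sub>d \<beta> \<in> perms (k + l)"
proof -
  have "{1..k + l} = {1..k} \<union> (\<lambda>x. x + k) ` {1..l}"
  proof (intro equalityI subsetI)
    fix x assume x: "x \<in> {1..k + l}"
    then have "x \<in> {1..k} \<or> (x - k \<in> {1..l} \<and> x = (x - k) + k)" by auto
    then show "x \<in> {1..k} \<union> (\<lambda>x. x + k) ` {1..l}" by blast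
  qed auto
  with assms show ?thesis
    by (auto simp: perms_iff dsum_def length_perms[OF assms(1)] distinct_map)
qed

lemma dsums_perms:
  assumes "\<And>\<tau>. \<tau> \<in> set \<tau>s \<Longrightarrow> \<tau> \<in> perms (length \<tau>)"
  shows "dsums \<tau>s \<in> perms (sum_list (map length \<tau>s))"
  using assms
proof (induction \<tau>s)
  case (Cons \<tau> \<tau>s)
  then have "\<tau> \<oplus>\<^sub>d dsums \<tau>s \<in> perms (length \<tau> + sum_list (map length \<tau>s))"
    by (intro dsum_perms) simp_all
  then show ?case by simp
qed (simp add: perms_iff)

lemma indecomposable_perms: "indecomposable \<tau> \<Longrightarrow> \<tau> \<in> perms (length \<tau>)"
  by (auto simp: indecomposable_def length_perms)

text \<open>In a proper direct sum the first entry lies in the lower summand and the last one in the upper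
  summand, so the first is smaller. The contrapositive is a simple test that applies to \<open>312\<close>, \<open>321\<close> and to
  all summands allowed in \<open>\<Omega>\<close>.\<close>

lemma indecomposable_if_last_le_hd:
  assumes "\<tau> \<in> perms n" "n \<ge> 1" "last \<tau> \<le> hd \<tau>"
  shows "indecomposable \<tau>"
  unfolding indecomposable_def
proof (intro conjI notI; (elim exE conjE bexE)?)
  show "\<exists>n\<ge>1. \<tau> \<in> perms n" using assms by blast
  fix k m \<sigma> \<rho>
  assume *: "1 \<le> k" "1 \<le> m" "\<sigma> \<in> perms k" "\<rho> \<in> perms m" "\<tau> = \<sigma> \<oplus>\<^sub>d \<rho>"
  have ne: "\<sigma> \<noteq> []" "\<rho> \<noteq> []" using * by (auto simp: perms_iff)
  then have "hd \<tau> \<in> set \<sigma>" "last \<tau> \<in> (\<lambda>x. x + k) ` set \<rho>"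
    using * by (auto simp: dsum_def last_map length_perms)
  then show False using *(3,4) assms(3) by (auto simp: perms_iff)
qed

section \<open>Pattern containment in direct sums\<close>

lemma same_order_append:
  assumes "length xs = length \<sigma>"
    and "\<And>x y. x \<in> set xs \<Longrightarrow> y \<in> set ys \<Longrightarrow> x < y"
    and "\<And>x y. x \<in> set \<sigma> \<Longrightarrow> y \<in> set \<tau> \<Longrightarrow> x < y"
  shows "same_order (xs @ ys) (\<sigma> @ \<tau>) \<longleftrightarrow> same_order xs \<sigma> \<and> same_order ys \<tau>"
proof
  assume so: "same_order (xs @ ys) (\<sigma> @ \<tau>)"
  have "same_order xs \<sigma>"
    unfolding same_order_def
  proof (intro conjI allI impI)
    fix i j assume "i < length xs" "j < length xs"
    then show "(xs ! i < xs ! j) = (\<sigma> ! i < \<sigma> ! j)"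
      using so[unfolded same_order_def, THEN conjunct2, rule_format, of i j] assms(1)
      by (simp add: nth_append)
  qed (use assms in auto)
  moreover have "same_order ys \<tau>"
    unfolding same_order_def
  proof (intro conjI allI impI)
    show "length ys = length \<tau>" using so assms(1) by (simp add: same_order_def)
    fix i j assume "i < length ys" "j < length ys"
    then show "(ys ! i < ys ! j) = (\<tau> ! i < \<tau> ! j)"
      using so[unfolded same_order_def, THEN conjunct2, rule_format, of "length xs + i" "length xs + j"] assms(1)
      by (simp add: nth_append)
  qed
  ultimately show "same_order xs \<sigma> \<and> same_order ys \<tau>" by blast
next
  assume so: "same_order xs \<sigma> \<and> same_order ys \<tau>"
  then have l: "length ys = length \<tau>" by (simp add: same_order_def)
  show "same_order (xs @ ys) (\<sigma> @ \<tau>)"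
    unfolding same_order_def
  proof (intro conjI allI impI)
    fix i j assume ij: "i < length (xs @ ys)" "j < length (xs @ ys)"
    let ?n = "length xs"
    consider "i < ?n" "j < ?n" | "i < ?n" "j \<ge> ?n" | "i \<ge> ?n" "j < ?n" | "i \<ge> ?n" "j \<ge> ?n"
      by linarith
    then show "((xs @ ys) ! i < (xs @ ys) ! j) = ((\<sigma> @ \<tau>) ! i < (\<sigma> @ \<tau>) ! j)"
    proof cases
      case 2
      then show ?thesis
        using ij l assms(1) assms(2)[of "xs ! i" "ys ! (j - ?n)"] assms(3)[of "\<sigma> ! i" "\<tau> ! (j - ?n)"]
        by (simp add: nth_append)
    next
      case 3
      then show ?thesis
        using ij l assms(1) assms(2)[of "xs ! j" "ys ! (i - ?n)"] assms(3)[of "\<sigma> ! j" "\<tau> ! (i - ?n)"]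
        by (simp add: nth_append)
    qed (use so ij assms(1) in \<open>auto simp: same_order_def nth_append\<close>)
  qed (use l assms in auto)
qed

lemma same_order_shift:
  "same_order (map (\<lambda>x. x + a) xs) ys \<longleftrightarrow> same_order xs ys"
  "same_order xs (map (\<lambda>x. x + a) ys) \<longleftrightarrow> same_order xs ys"
  by (auto simp: same_order_def)

text \<open>Comparing two designated entries by position: same-length prefixes \<open>us\<close>, \<open>us'\<close> and gaps \<open>vs\<close>,
  \<open>vs'\<close> put \<open>x\<close>, \<open>y\<close> at the positions of \<open>x'\<close>, \<open>y'\<close>.\<close>

lemma same_order_less:
  assumes "same_order (us @ [x] @ vs @ [y] @ ws) (us' @ [x'] @ vs' @ [y'] @ ws')"
    "length us = length us'" "length vs = length vs'"
  shows "x < y \<longleftrightarrow> x' < y'"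
  using assms(1)[unfolded same_order_def, THEN conjunct2, rule_format,
     of "length us" "Suc (length us + length vs)"] assms(2,3)
  by (simp add: nth_append)

lemma perm_contains_Nil [simp]: "perm_contains \<pi> []"
  by (auto simp: perm_contains_def same_order_def)

lemma perm_contains_Nil_iff [simp]: "perm_contains [] \<sigma> \<longleftrightarrow> \<sigma> = []"
  by (auto simp: perm_contains_def same_order_def dest: list_emb_Nil2)

lemma perm_contains_mono: "perm_contains \<rho> \<sigma> \<Longrightarrow> subseq \<rho> \<pi> \<Longrightarrow> perm_contains \<pi> \<sigma>"
  unfolding perm_contains_def by (meson subseq_order.order_trans)

lemma perm_contains_shift: "perm_contains (map (\<lambda>x. x + a) \<pi>) \<sigma> \<longleftrightarrow> perm_contains \<pi> \<sigma>"
  unfolding perm_contains_def subseq_conv_nths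
  by (auto simp: nths_map same_order_shift)

text \<open>An occurrence of \<open>\<sigma>\<close> in \<open>\<alpha> \<oplus>\<^sub>d \<beta>\<close> splits into its entries in \<open>\<alpha>\<close> and its entries in \<open>\<beta>\<close>. The former
  come first and are smaller, and this cuts \<open>\<sigma>\<close> itself into a direct sum.\<close>

lemma perm_contains_dsumE:
  assumes "\<alpha> \<in> perms k" "\<beta> \<in> perms l" "\<sigma> \<in> perms n" "perm_contains (\<alpha> \<oplus>\<^sub>d \<beta>) \<sigma>"
  obtains i j \<sigma>1 \<sigma>2 where "\<sigma>1 \<in> perms i" "\<sigma>2 \<in> perms j" "\<sigma> = \<sigma>1 \<oplus>\<^sub>d \<sigma>2"
    "perm_contains \<alpha> \<sigma>1" "perm_contains \<beta> \<sigma>2"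
proof -
  let ?\<beta> = "map (\<lambda>x. x + length \<alpha>) \<beta>"
  from assms(4) obtain xs ys where s: "subseq xs \<alpha>" "subseq ys ?\<beta>" "same_order (xs @ ys) \<sigma>"
    by (auto simp: perm_contains_def dsum_def subseq_append_iff)
  define \<sigma>1 \<rho> where "\<sigma>1 = take (length xs) \<sigma>" and "\<rho> = drop (length xs) \<sigma>"
  have len: "length xs = length \<sigma>1" "length ys = length \<rho>" and \<sigma>: "\<sigma> = \<sigma>1 @ \<rho>"
    using s(3) by (auto simp: same_order_def \<sigma>1_def \<rho>_def)
  have lxy: "x < y" if "x \<in> set xs" "y \<in> set ys" for x y
  proof -
    have "x \<in> set \<alpha>" "y \<in> set ?\<beta>"
      using that s(1,2) notin_set_nthsI by (auto simp: subseq_conv_nths dest: in_set_nthsD)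
    then show ?thesis using assms(1,2) length_perms[OF assms(1)] by (auto simp: perms_iff)
  qed
  have low: "x < y" if "x \<in> set \<sigma>1" "y \<in> set \<rho>" for x y
  proof -
    from that obtain i j where ij: "i < length \<sigma>1" "x = \<sigma>1 ! i" "j < length \<rho>" "y = \<rho> ! j"
      by (auto simp: in_set_conv_nth)
    with lxy[of "xs ! i" "ys ! j"] len
      s(3)[unfolded same_order_def, THEN conjunct2, rule_format, of i "length xs + j"]
    show ?thesis by (simp add: \<sigma> nth_append)
  qed
  from assms(3) \<sigma> have "\<sigma>1 @ \<rho> \<in> perms n" by simp
  from dsum_split[OF this low] obtain \<tau> where \<tau>:
    "\<sigma>1 \<in> perms (length \<sigma>1)" "\<tau> \<in> perms (n - length \<sigma>1)" "\<rho> = map (\<lambda>x. x + length \<sigma>1) \<tau>"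
    "\<sigma>1 @ \<rho> = \<sigma>1 \<oplus>\<^sub>d \<tau>" by blast
  have "same_order xs \<sigma>1" "same_order ys \<rho>"
    using s(3) same_order_append[of xs \<sigma>1 ys \<rho>] len lxy low \<sigma> by auto
  then have "perm_contains \<alpha> \<sigma>1" "perm_contains ?\<beta> \<tau>"
    using s(1,2) \<tau>(3) by (auto simp: perm_contains_def same_order_shift)
  then show ?thesis
    using that[of \<sigma>1 "length \<sigma>1" \<tau> "n - length \<sigma>1"] \<tau> \<sigma> by (simp add: perm_contains_shift)
qed

lemma perm_contains_dsumI:
  assumes "\<alpha> \<in> perms k" "\<beta> \<in> perms l" "\<sigma> \<in> perms i" "\<tau> \<in> perms j"
    "perm_contains \<alpha> \<sigma>" "perm_contains \<beta> \<tau>"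
  shows "perm_contains (\<alpha> \<oplus>\<^sub>d \<beta>) (\<sigma> \<oplus>\<^sub>d \<tau>)"
proof -
  from assms(5,6) obtain xs ys where s: "subseq xs \<alpha>" "same_order xs \<sigma>" "subseq ys \<beta>" "same_order ys \<tau>"
    by (auto simp: perm_contains_def)
  have xy: "set xs \<subseteq> set \<alpha>" "set ys \<subseteq> set \<beta>"
    using s(1,3) by (auto simp: subseq_conv_nths dest: in_set_nthsD)
  have "same_order (xs @ map (\<lambda>x. x + length \<alpha>) ys) (\<sigma> @ map (\<lambda>x. x + length \<sigma>) \<tau>)"
  proof (subst same_order_append)
    show "length xs = length \<sigma>" using s by (simp add: same_order_def)
  qed (use s xy assms(1-4) length_perms[OF assms(1)] length_perms[OF assms(3)] in
      \<open>fastforce simp: same_order_shift perms_iff\<close>)+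
  moreover have "subseq (xs @ map (\<lambda>x. x + length \<alpha>) ys) (\<alpha> \<oplus>\<^sub>d \<beta>)"
    using s by (auto simp: dsum_def intro!: list_emb_append_mono subseq_map)
  ultimately show ?thesis by (auto simp: perm_contains_def dsum_def)
qed

text \<open>By uniqueness of the decomposition, the cut of the pattern found in
  \<open>perm_contains_dsumE\<close> must fall between two of its indecomposable summands. This reduces
  containment between direct sums to one host summand at a time.\<close>

lemma perm_contains_dsum_dsums:
  assumes "\<alpha> \<in> perms k" "\<beta> \<in> perms l" and ind: "\<forall>\<tau>\<in>set \<tau>s. indecomposable \<tau>"
  shows "perm_contains (\<alpha> \<oplus>\<^sub>d \<beta>) (dsums \<tau>s) \<longleftrightarrow>
    (\<exists>us vs. \<tau>s = us @ vs \<and> perm_contains \<alpha> (dsums us) \<and> perm_contains \<beta> (dsums vs))"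
proof
  assume c: "perm_contains (\<alpha> \<oplus>\<^sub>d \<beta>) (dsums \<tau>s)"
  have "dsums \<tau>s \<in> perms (sum_list (map length \<tau>s))"
    using ind by (intro dsums_perms indecomposable_perms) blast
  then obtain i j \<sigma>1 \<sigma>2 where
    s: "\<sigma>1 \<in> perms i" "\<sigma>2 \<in> perms j" "dsums \<tau>s = \<sigma>1 \<oplus>\<^sub>d \<sigma>2" "perm_contains \<alpha> \<sigma>1" "perm_contains \<beta> \<sigma>2"
    by (rule perm_contains_dsumE[OF assms(1,2) _ c])
  define us vs where "us = decomposition \<sigma>1" and "vs = decomposition \<sigma>2"
  note d1 = decomposition[OF s(1), folded us_def] and d2 = decomposition[OF s(2), folded vs_def]
  have "\<tau>s = us @ vs"
  proof (rule dsums_unique[OF ind])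
    show "\<forall>\<tau>\<in>set (us @ vs). indecomposable \<tau>" using d1(1) d2(1) by auto
    show "dsums \<tau>s = dsums (us @ vs)" by (simp only: dsums_append d1(2) d2(2) s(3))
  qed
  moreover have "perm_contains \<alpha> (dsums us)" "perm_contains \<beta> (dsums vs)"
    using s(4,5) by (simp_all only: d1(2) d2(2))
  ultimately show "\<exists>us vs. \<tau>s = us @ vs \<and> perm_contains \<alpha> (dsums us) \<and> perm_contains \<beta> (dsums vs)"
    by blast
next
  assume "\<exists>us vs. \<tau>s = us @ vs \<and> perm_contains \<alpha> (dsums us) \<and> perm_contains \<beta> (dsums vs)"
  then obtain us vs where uv: "\<tau>s = us @ vs" "perm_contains \<alpha> (dsums us)" "perm_contains \<beta> (dsums vs)"
    by blast
  have p: "dsums us \<in> perms (sum_list (map length us))" "dsums vs \<in> perms (sum_list (map length vs))"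
    using ind uv by (auto intro!: dsums_perms indecomposable_perms)
  show "perm_contains (\<alpha> \<oplus>\<^sub>d \<beta>) (dsums \<tau>s)"
    unfolding uv(1) dsums_append
    by (rule perm_contains_dsumI[OF assms(1,2) p uv(2,3)])
qed

lemma perm_contains_dsum_indecomposable:
  assumes "\<alpha> \<in> perms k" "\<beta> \<in> perms l" "indecomposable \<sigma>"
  shows "perm_contains (\<alpha> \<oplus>\<^sub>d \<beta>) \<sigma> \<longleftrightarrow> perm_contains \<alpha> \<sigma> \<or> perm_contains \<beta> \<sigma>"
proof -
  have [simp]: "\<sigma> \<oplus>\<^sub>d [] = \<sigma>" by (simp add: dsum_def)
  show ?thesis
    using perm_contains_dsum_dsums[OF assms(1,2), of "[\<sigma>]"] assms(3)
    by (simp add: Cons_eq_append_conv conj_disj_distribR ex_disj_distrib disj_commute)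
qed

section \<open>Permutations avoiding 312 and 321\<close>

lemma subseq_sorted_wrt: "subseq xs ys \<Longrightarrow> sorted_wrt P ys \<Longrightarrow> sorted_wrt P xs"
  by (induction rule: list_emb.induct) (auto elim!: list_emb_set)

lemma shift_one_perms: "m \<ge> 1 \<Longrightarrow> shift_one m \<in> perms m"
  by (auto simp: shift_one_def perms_iff)

lemma shift_two_perms: "m \<ge> 2 \<Longrightarrow> shift_two m \<in> perms m"
  by (auto simp: shift_two_def perms_iff)

lemma shift_one_indecomposable: "m \<ge> 1 \<Longrightarrow> indecomposable (shift_one m)"
  by (rule indecomposable_if_last_le_hd[OF shift_one_perms])
    (auto simp: shift_one_def upt_conv_Cons hd_append)

lemma length_shift_one [simp]: "m \<ge> 1 \<Longrightarrow> length (shift_one m) = m"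
  by (simp add: shift_one_def del: upt_Suc)

lemma length_shift_two [simp]: "m \<ge> 2 \<Longrightarrow> length (shift_two m) = m"
  by (simp add: shift_two_def del: upt_Suc)

lemma indecomposable_312_321: "indecomposable [3, 1, 2]" "indecomposable [3, 2, 1]"
  by (rule indecomposable_if_last_le_hd[of _ 3]; force simp: perms_iff)+

text \<open>At most one entry of an occurrence is the final \<open>1\<close>, so its first two entries lie in the
  increasing part \<open>2 3 \<dots> m\<close>, whereas both \<open>312\<close> and \<open>321\<close> start with a descent.\<close>

lemma shift_one_avoids:
  assumes "length \<sigma> = 3" "\<sigma> ! 1 < \<sigma> ! 0"
  shows "perm_avoids (shift_one m) \<sigma>"
proof
  assume "perm_contains (shift_one m) \<sigma>"
  then obtain xa xb where x: "subseq xa [2..<m + 1]" "subseq xb [1]" "same_order (xa @ xb) \<sigma>"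
    by (auto simp: perm_contains_def shift_one_def subseq_append_iff simp del: upt_Suc)
  have "length xb \<le> 1" using list_emb_length[OF x(2)] by simp
  then have "length xa \<ge> 2" using x(3) assms(1) by (simp add: same_order_def)
  moreover have "sorted_wrt (<) xa"
    by (rule subseq_sorted_wrt[OF x(1)]) (rule sorted_wrt_upt)
  ultimately have "xa ! 0 < xa ! 1" by (simp add: sorted_wrt_nth_less)
  moreover have "(xa @ xb) ! 1 < (xa @ xb) ! 0"
    using x(3) assms \<open>length xa \<ge> 2\<close> unfolding same_order_def by force
  ultimately show False using \<open>length xa \<ge> 2\<close> by (cases xa) (auto simp: nth_append split: if_splits)
qed

lemma dsums_blocks_perms:
  assumes "\<forall>m\<in>set d. m \<ge> 1" "\<And>m. m \<ge> 1 \<Longrightarrow> f m \<in> perms m"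
  shows "dsums (map f d) \<in> perms (sum_list d)"
  using assms(1)
proof (induction d)
  case (Cons m d)
  then show ?case using dsum_perms[OF assms(2)[of m]] by simp
qed (simp add: perms_iff)

lemma dsums_shift_one_avoids:
  assumes "\<forall>m\<in>set d. m \<ge> 1" "\<sigma> \<in> {[3, 1, 2], [3, 2, 1]}"
  shows "perm_avoids (dsums (map shift_one d)) \<sigma>"
  using assms(1)
proof (induction d)
  case Nil
  then show ?case using assms(2) by auto
next
  case (Cons m d)
  have "perm_avoids (shift_one m) \<sigma>"
    by (rule shift_one_avoids) (use assms(2) in auto)
  moreover have "indecomposable \<sigma>" using assms(2) indecomposable_312_321 by auto
  ultimately show ?case
    using Cons dsums_blocks_perms[of d shift_one, OF _ shift_one_perms]
    by (simp add: perm_contains_dsum_indecomposable[OF shift_one_perms])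
qed

text \<open>Write \<open>\<pi> = p 1 q\<close>. A descent in \<open>p\<close> followed by \<open>1\<close> would be a \<open>321\<close>, and an entry of \<open>p\<close>
  above one of \<open>q\<close>, with \<open>1\<close> between them, would be a \<open>312\<close>. So \<open>p\<close> is increasing and lies below
  \<open>q\<close>: \<open>p 1\<close> is the first block \<open>2 3 \<dots> m 1\<close>, and what follows it is again such a permutation.\<close>

lemma avoids_312_321_decompose:
  assumes "\<pi> \<in> perms n" "perm_avoids \<pi> [3, 1, 2]" "perm_avoids \<pi> [3, 2, 1]"
  shows "\<exists>d\<in>compositions n. \<pi> = dsums (map shift_one d)"
  using assms
proof (induction n arbitrary: \<pi> rule: less_induct)
  case (less n)
  show ?case
  proof (cases "n = 0")
    case True
    with less.prems(1) show ?thesis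
      by (intro bexI[of _ "[]"]) (simp_all add: compositions_def perms_iff)
  next
    case False
    with less.prems(1) have "1 \<in> set \<pi>" by (simp add: perms_iff)
    then obtain p q where pq: "\<pi> = p @ 1 # q" by (meson split_list)
    have dist: "distinct \<pi>" and pos: "\<forall>x\<in>set \<pi>. x \<ge> 1"
      using less.prems(1) by (auto simp: perms_iff)
    have big: "x > 1" if "x \<in> set p \<union> set q" for x
      using that dist pos pq by (cases "x = 1") (auto simp: le_neq_implies_less)
    have inc: "x < y" if "p = u @ x # v @ y # w" for u x v y w
    proof (rule ccontr)
      assume "\<not> x < y"
      moreover have "x \<noteq> y" "y > 1" using that dist pq big by auto
      ultimately have "same_order [x, y, 1] [3, 2, 1]"
        by (auto simp: same_order_def less_Suc_eq nth_Cons')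
      moreover have "subseq ([] @ [x] @ [] @ [y] @ [] @ [1] @ []) (u @ [x] @ v @ [y] @ w @ [1] @ q)"
        by (intro list_emb_append_mono) auto
      ultimately show False
        using less.prems(3) pq that by (auto simp: perm_contains_def)
    qed
    have low: "x < y" if "x \<in> set p" "y \<in> set q" for x y
    proof (rule ccontr)
      assume "\<not> x < y"
      moreover have "x \<noteq> y" "y > 1" using that dist pq big by auto
      ultimately have "same_order [x, 1, y] [3, 1, 2]"
        by (auto simp: same_order_def less_Suc_eq nth_Cons')
      moreover have "subseq ([x] @ [1] @ [y]) (p @ [1] @ q)"
        using that by (intro list_emb_append_mono) (auto simp: subseq_singleton_left)
      ultimately show False
        using less.prems(2) pq by (auto simp: perm_contains_def)
    qed
    let ?m = "Suc (length p)"
    have "(p @ [1]) @ q \<in> perms n" using less.prems(1) pq by simp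
    then obtain \<rho> where \<rho>: "p @ [1] \<in> perms ?m" "\<rho> \<in> perms (n - ?m)" "q = map (\<lambda>x. x + ?m) \<rho>"
      "(p @ [1]) @ q = (p @ [1]) \<oplus>\<^sub>d \<rho>"
      by (rule dsum_split) (use low big in auto)
    have "p = [2..<?m + 1]"
    proof (rule sorted_distinct_set_unique)
      have "x \<le> y" if "i < j" "j < length p" "x = p ! i" "y = p ! j" for i j x y
      proof -
        have "p = take i p @ x # take (j - Suc i) (drop (Suc i) p) @ y # drop (Suc j) p"
          using that id_take_nth_drop[of i p] id_take_nth_drop[of "j - Suc i" "drop (Suc i) p"] by simp
        then show ?thesis using inc less_imp_le by blast
      qed
      then show "sorted p" by (simp add: sorted_iff_nth_mono_less)
      show "distinct p" using dist pq by simp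
      have "set p = {1..?m} - {1}"
        using \<rho>(1) by (auto simp: perms_iff)
      also have "{1..?m} - {1} = {2..<?m + 1}" by auto
      finally show "set p = set [2..<?m + 1]" by (simp only: set_upt)
    qed (simp_all del: upt_Suc)
    then have first: "p @ [1] = shift_one ?m"
      unfolding shift_one_def by (rule arg_cong)
    have sub: "subseq (map (\<lambda>x. x + ?m) \<rho>) \<pi>"
      using pq \<rho>(3) by (metis subseq_drop_many subseq_order.order_refl list_emb_Cons)
    have av: "perm_avoids \<rho> \<tau>" if "perm_avoids \<pi> \<tau>" for \<tau>
      using that perm_contains_mono[OF _ sub, of \<tau>] by (auto simp only: perm_contains_shift)
    have "n - ?m < n" using False by simp
    from less.IH[OF this \<rho>(2) av[OF less.prems(2)] av[OF less.prems(3)]]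
    obtain d where d: "d \<in> compositions (n - ?m)" "\<rho> = dsums (map shift_one d)" by blast
    have "?m \<le> n" using pq length_perms[OF less.prems(1)] by simp
    then have "?m # d \<in> compositions n" using d(1) by (simp add: compositions_def)
    moreover have "\<pi> = dsums (map shift_one (?m # d))"
    proof -
      have "\<pi> = (p @ [1]) @ q" using pq by simp
      also note \<rho>(4)
      finally show ?thesis by (simp only: first d(2) dsums_Cons list.map)
    qed
    ultimately show ?thesis by blast
  qed
qed

lemma bij_betw_dsums_shift_one:
  "bij_betw (\<lambda>d. dsums (map shift_one d)) (compositions n)
     {\<pi> \<in> perms n. perm_avoids \<pi> [3, 1, 2] \<and> perm_avoids \<pi> [3, 2, 1]}"
proof (rule bij_betw_imageI)
  show "inj_on (\<lambda>d. dsums (map shift_one d)) (compositions n)"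
  proof (rule inj_onI)
    fix c d assume *: "c \<in> compositions n" "d \<in> compositions n"
      "dsums (map shift_one c) = dsums (map shift_one d)"
    then have p: "\<forall>m\<in>set c. m \<ge> 1" "\<forall>m\<in>set d. m \<ge> 1"
      by (auto simp: compositions_def Suc_le_eq)
    then have "map shift_one c = map shift_one d"
      by (intro dsums_unique *(3)) (auto simp: shift_one_indecomposable)
    then have "map length (map shift_one c) = map length (map shift_one d)" by simp
    then have "map (\<lambda>m. m) c = map (\<lambda>m. m) d"
      using p by (simp add: o_def cong: map_cong)
    then show "c = d" by simp
  qed
  have "dsums (map shift_one d) \<in> perms n \<and> perm_avoids (dsums (map shift_one d)) [3, 1, 2] \<and>
      perm_avoids (dsums (map shift_one d)) [3, 2, 1]" if "d \<in> compositions n" for d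
  proof -
    have "\<forall>m\<in>set d. m \<ge> 1" "sum_list d = n"
      using that by (auto simp: compositions_def Suc_le_eq)
    then show ?thesis
      using dsums_shift_one_avoids[of d] dsums_blocks_perms[of d shift_one, OF _ shift_one_perms] by auto
  qed
  then show "(\<lambda>d. dsums (map shift_one d)) ` compositions n =
    {\<pi> \<in> perms n. perm_avoids \<pi> [3, 1, 2] \<and> perm_avoids \<pi> [3, 2, 1]}"
    using avoids_312_321_decompose by blast
qed

section \<open>Squares of direct sums\<close>

text \<open>Composition of direct sums acts on each summand separately, so squaring a permutation squares
  its blocks.\<close>

lemma perm_comp_dsum:
  assumes "\<alpha> \<in> perms k" "\<beta> \<in> perms l"
  shows "perm_comp (\<alpha> \<oplus>\<^sub>d \<beta>) (\<alpha> \<oplus>\<^sub>d \<beta>) = perm_comp \<alpha> \<alpha> \<oplus>\<^sub>d perm_comp \<beta> \<beta>"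
proof -
  have "\<forall>x\<in>set \<alpha>. 1 \<le> x \<and> x \<le> length \<alpha>" "\<forall>x\<in>set \<beta>. 1 \<le> x \<and> x \<le> length \<beta>"
    using assms length_perms[OF assms(1)] length_perms[OF assms(2)] by (auto simp: perms_iff)
  then show ?thesis
    by (auto simp: perm_comp_def dsum_def nth_append add.commute)
qed

text \<open>This is the square of \<open>shift_one m\<close>. Length 1 is exceptional: \<open>shift_two 1\<close> would be the list
  \<open>[1, 2]\<close>. For \<open>m = 2\<close> the value is the identity \<open>12\<close>, which agrees with \<open>shift_two 2\<close>.\<close>

definition square_block :: "nat \<Rightarrow> nat list" where
  "square_block m = (if m = 1 then [1] else shift_two m)"

lemma square_block_perms: "m \<ge> 1 \<Longrightarrow> square_block m \<in> perms m"
  by (cases "m = 1") (simp_all add: square_block_def shift_two_perms, simp add: perms_iff)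

lemma perm_comp_shift_one:
  assumes "m \<ge> 1"
  shows "perm_comp (shift_one m) (shift_one m) = square_block m"
proof (cases "m = 1")
  case True
  then show ?thesis by (simp add: perm_comp_def square_block_def shift_one_def)
next
  case False
  with assms obtain k where k: "m = Suc (Suc k)"
    by (metis Suc_eq_plus1 le_Suc_ex plus_1_eq_Suc not0_implies_Suc add_0_right)
  \<comment> \<open>\<open>shift_one m\<close> maps \<open>2, \<dots>, m - 1\<close> to \<open>3, \<dots>, m\<close>, then \<open>m\<close> to \<open>1\<close> and \<open>1\<close> to \<open>2\<close>.\<close>
  have "[2..<m + 1] = [2..<m] @ [m]" using k by simp
  moreover have "map (\<lambda>i. shift_one m ! (i - 1)) [2..<m] = [3..<m + 1]"
    by (rule nth_equalityI) (auto simp: k shift_one_def nth_append simp del: upt_Suc)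
  moreover have "shift_one m ! (m - 1) = 1" "shift_one m ! 0 = 2"
    by (auto simp: shift_one_def k nth_append simp del: upt_Suc)
  ultimately show ?thesis
    using False
    by (subst (2) shift_one_def) (simp add: perm_comp_def square_block_def shift_two_def del: upt_Suc)
qed

lemma square_dsums_shift_one:
  assumes "\<forall>m\<in>set d. m \<ge> 1"
  shows "perm_comp (dsums (map shift_one d)) (dsums (map shift_one d)) = dsums (map square_block d)"
  using assms
proof (induction d)
  case (Cons m d)
  then show ?case
    using perm_comp_dsum[OF shift_one_perms dsums_blocks_perms[of d shift_one, OF _ shift_one_perms]]
    by (simp add: perm_comp_shift_one)
qed (simp add: perm_comp_def)

section \<open>Replacing runs of ones\<close>

text \<open>The least length of a squared block containing \<open>12\<dots>r\<close>: for \<open>r \<ge> 3\<close> the increasing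
  subsequence must avoid the trailing \<open>1 2\<close> of \<open>3 4 \<dots> m 1 2\<close>, which costs two extra entries; for
  \<open>r = 2\<close> that tail is itself an occurrence.\<close>

definition inflate :: "nat \<Rightarrow> nat" where
  "inflate r = (if r \<ge> 3 then r + 2 else r)"

lemma C_incr_inflate: "C_incr r = map inflate ` compositions r"
  by (simp add: C_incr_def inflate_def[abs_def])

text \<open>A description of \<open>replace_runs\<close> that does not refer to maximal runs: any group of consecutive
  ones may be merged into a single part. It can be peeled off from the left, which suits inductions
  over the host composition.\<close>

inductive coarsening :: "nat list \<Rightarrow> nat list \<Rightarrow> bool" where
  Nil: "coarsening [] []"
| keep: "coarsening b c \<Longrightarrow> coarsening (x # b) (x # c)"
| merge: "coarsening b c \<Longrightarrow> r \<ge> 1 \<Longrightarrow> coarsening (replicate r 1 @ b) (inflate r # c)"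

lemma coarsening_Nil2 [simp]: "coarsening b [] \<longleftrightarrow> b = []"
  by (auto intro: coarsening.Nil elim: coarsening.cases)

lemma coarsening_Nil1 [simp]: "coarsening [] c \<longleftrightarrow> c = []"
  by (auto intro: coarsening.Nil elim: coarsening.cases)

lemma ones_prefix:
  obtains s b' where "b = replicate s (1::nat) @ b'" "b' = [] \<or> hd b' \<noteq> 1"
    "takeWhile (\<lambda>y. y = 1) b = replicate s 1" "dropWhile (\<lambda>y. y = 1) b = b'"
proof -
  have t: "takeWhile (\<lambda>y. y = 1) b = replicate (length (takeWhile (\<lambda>y. y = 1) b)) 1"
    by (rule replicate_length_same[symmetric]) (auto dest: set_takeWhileD)
  show ?thesis
  proof (rule that[OF _ _ t refl])
    show "b = replicate (length (takeWhile (\<lambda>y. y = 1) b)) 1 @ dropWhile (\<lambda>y. y = 1) b"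
      using t takeWhile_dropWhile_id by metis
  qed (use hd_dropWhile[of "\<lambda>y. y = 1" b] in auto)
qed

lemma replace_runs_ones:
  assumes "b = [] \<or> hd b \<noteq> 1"
  shows "replace_runs (replicate s 1 @ b) =
    {map inflate p @ c | p c. p \<in> compositions s \<and> c \<in> replace_runs b}"
proof (cases s)
  case 0
  have "p = []" if "p \<in> compositions 0" for p
    using that by (cases p) (auto simp: compositions_def)
  then have "compositions 0 = {[]}" by (auto simp: compositions_def)
  with 0 show ?thesis by auto
next
  case (Suc s')
  have "takeWhile (\<lambda>y. y = 1) b = []" "dropWhile (\<lambda>y. y = 1) b = b"
    using assms by (cases b; simp)+
  then have "takeWhile (\<lambda>y. y = 1) (replicate s' 1 @ b) = replicate s' 1"
    "dropWhile (\<lambda>y. y = 1) (replicate s' 1 @ b) = b"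
    by (simp_all add: takeWhile_append dropWhile_append)
  with Suc show ?thesis by (auto simp: C_incr_inflate)
qed

text \<open>Prepending ones lengthens the maximal run at the front, and a choice for the shorter run extends
  by one part to a choice for the longer one.\<close>

lemma replace_runs_merge:
  assumes "c \<in> replace_runs b" "r \<ge> 1"
  shows "inflate r # c \<in> replace_runs (replicate r 1 @ b)"
proof -
  obtain s b' where b: "b = replicate s 1 @ b'" "b' = [] \<or> hd b' \<noteq> 1" by (rule ones_prefix)
  from assms(1)[unfolded b(1) replace_runs_ones[OF b(2)]] obtain p c' where
    c: "c = map inflate p @ c'" "p \<in> compositions s" "c' \<in> replace_runs b'" by blast
  have "r # p \<in> compositions (r + s)" using c(2) assms(2) by (simp add: compositions_def)
  moreover have "inflate r # c = map inflate (r # p) @ c'" using c(1) by simp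
  ultimately have "inflate r # c \<in> replace_runs (replicate (r + s) 1 @ b')"
    using c(3) unfolding replace_runs_ones[OF b(2)] by blast
  then show ?thesis by (simp add: b(1) replicate_add)
qed

lemma coarsening_ones:
  assumes "coarsening b c" "p \<in> compositions s"
  shows "coarsening (replicate s 1 @ b) (map inflate p @ c)"
  using assms(2)
proof (induction p arbitrary: s)
  case Nil
  with assms(1) show ?case by (simp add: compositions_def)
next
  case (Cons r p)
  then have r: "r \<ge> 1" "s = r + (s - r)" and "p \<in> compositions (s - r)"
    by (auto simp: compositions_def)
  then have "coarsening (replicate r 1 @ replicate (s - r) 1 @ b) (inflate r # map inflate p @ c)"
    using Cons.IH by (intro coarsening.merge)
  then show ?case using r(2) by (metis append_assoc append_Cons list.map(2) replicate_add)
qed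

lemma replace_runs_iff_coarsening: "c \<in> replace_runs b \<longleftrightarrow> coarsening b c"
proof
  assume "c \<in> replace_runs b"
  then show "coarsening b c"
  proof (induction b arbitrary: c rule: replace_runs.induct)
    case (2 x xs)
    show ?case
    proof (cases "x = 1")
      case True
      obtain s b where b: "xs = replicate s 1 @ b" "takeWhile (\<lambda>y. y = 1) xs = replicate s 1"
        "dropWhile (\<lambda>y. y = 1) xs = b" by (rule ones_prefix)
      from "2.prems" True b obtain p c' where
        c: "c = map inflate p @ c'" "p \<in> compositions (Suc s)" "c' \<in> replace_runs b"
        by (auto simp: C_incr_inflate)
      have "coarsening b c'" using "2.IH"(1)[OF True, of c'] c(3) b(3) by simp
      from coarsening_ones[OF this c(2)] show ?thesis by (simp add: c(1) b(1) True)
    next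
      case False
      with 2 show ?thesis by (auto intro: coarsening.keep)
    qed
  qed simp
next
  assume "coarsening b c"
  then show "c \<in> replace_runs b"
  proof induction
    case (keep b c x)
    \<comment> \<open>A part 1 that is kept is a merged group of a single one.\<close>
    then show ?case
      using replace_runs_merge[of c b 1] by (cases "x = 1") (simp_all add: inflate_def)
  next
    case (merge b c r)
    then show ?case by (intro replace_runs_merge)
  qed simp
qed

section \<open>Containment of compositions\<close>

text \<open>Containment of compositions is an instance of the inductive list embedding, which gives access
  to induction.\<close>

lemma comp_contains_iff_list_emb: "comp_contains d c \<longleftrightarrow> list_emb (\<le>) c d"
proof
  assume "comp_contains d c"
  then show "list_emb (\<le>) c d"
  proof (induction d arbitrary: c)
    case Nil
    then show ?case by (cases c) (auto simp: comp_contains_def)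
  next
    case (Cons m d)
    from Cons.prems obtain i where mono: "strict_mono_on {..<length c} i"
      and i: "\<And>j. j < length c \<Longrightarrow> i j < Suc (length d) \<and> (m # d) ! i j \<ge> c ! j"
      by (auto simp: comp_contains_def)
    show ?case
    proof (cases c)
      case c: (Cons x c')
      have less: "i j < i k" if "j < k" "k < length c" for j k
        using mono that by (auto simp: strict_mono_on_def)
      show ?thesis
      proof (cases "i 0 = 0")
        case True
        have pos: "i (Suc j) > 0" if "j < length c'" for j
          using less[of 0 "Suc j"] that c by simp
        have "strict_mono_on {..<length c'} (\<lambda>j. i (Suc j) - 1)"
          using pos less c by (auto intro!: strict_mono_onI diff_less_mono simp: Suc_le_eq)
        moreover have "i (Suc j) - 1 < length d \<and> d ! (i (Suc j) - 1) \<ge> c' ! j" if "j < length c'" for j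
          using pos[OF that] i[of "Suc j"] that c by (auto simp: nth_Cons')
        ultimately have "comp_contains d c'" unfolding comp_contains_def by blast
        then show ?thesis using Cons.IH i[of 0] True c by simp
      next
        case False
        have pos: "i j > 0" if "j < length c" for j
          using less[of 0 j] that False by (cases j) auto
        have "strict_mono_on {..<length c} (\<lambda>j. i j - 1)"
          using pos less by (auto intro!: strict_mono_onI diff_less_mono simp: Suc_le_eq)
        moreover have "i j - 1 < length d \<and> d ! (i j - 1) \<ge> c ! j" if "j < length c" for j
          using pos[OF that] i[of j] that by (auto simp: nth_Cons')
        ultimately have "comp_contains d c" unfolding comp_contains_def by blast
        then show ?thesis using Cons.IH by (intro list_emb_Cons)
      qed
    qed simp
  qed
next
  assume "list_emb (\<le>) c d"
  then show "comp_contains d c"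
  proof induction
    case (list_emb_Nil d)
    show ?case by (auto simp: comp_contains_def strict_mono_on_def)
  next
    case (list_emb_Cons c d m)
    then obtain i where "strict_mono_on {..<length c} i" "\<forall>j<length c. i j < length d \<and> c ! j \<le> d ! i j"
      by (auto simp: comp_contains_def)
    then show ?case
      unfolding comp_contains_def
      by (intro exI[of _ "\<lambda>j. Suc (i j)"]) (auto simp: strict_mono_on_def)
  next
    case (list_emb_Cons2 x m c d)
    then obtain i where "strict_mono_on {..<length c} i" "\<forall>j<length c. i j < length d \<and> c ! j \<le> d ! i j"
      by (auto simp: comp_contains_def)
    with list_emb_Cons2(1) show ?case
      unfolding comp_contains_def
      by (intro exI[of _ "\<lambda>j. case j of 0 \<Rightarrow> 0 | Suc k \<Rightarrow> Suc (i k)"])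
        (auto simp: strict_mono_on_def split: nat.split)
  qed
qed

text \<open>Here \<open>b\<close> lists the parts, in the base composition, of some consecutive summands of the pattern.
  The predicate says when these can all be found in one squared block of length \<open>m\<close>: nothing, a
  single summand, or an increasing run. It is also the condition for \<open>b\<close> to be absorbed by
  one part \<open>m\<close> of a composition.\<close>

definition fits :: "nat \<Rightarrow> nat list \<Rightarrow> bool" where
  "fits m b \<longleftrightarrow> b = [] \<or> (\<exists>x. b = [x] \<and> x \<le> m) \<or> (\<exists>r\<ge>1. b = replicate r 1 \<and> inflate r \<le> m)"

lemma coarsening_emb_Cons:
  "(\<exists>c. coarsening b c \<and> list_emb (\<le>) c (m # d)) \<longleftrightarrow>
   (\<exists>us vs. b = us @ vs \<and> fits m us \<and> (\<exists>c. coarsening vs c \<and> list_emb (\<le>) c d))"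
proof
  assume "\<exists>c. coarsening b c \<and> list_emb (\<le>) c (m # d)"
  then obtain c where "list_emb (\<le>) c (m # d)" and c: "coarsening b c" by blast
  then show "\<exists>us vs. b = us @ vs \<and> fits m us \<and> (\<exists>c. coarsening vs c \<and> list_emb (\<le>) c d)"
  proof cases
    case list_emb_Nil
    with c have "b = [] @ []" by simp
    then show ?thesis using list_emb.list_emb_Nil coarsening.Nil unfolding fits_def by blast
  next
    case list_emb_Cons
    with c have "b = [] @ b \<and> fits m [] \<and> (\<exists>c. coarsening b c \<and> list_emb (\<le>) c d)"
      by (auto simp: fits_def)
    then show ?thesis by blast
  next
    case (list_emb_Cons2 x c')
    from c[unfolded list_emb_Cons2(1)] show ?thesis
    proof cases
      case (keep b')
      with list_emb_Cons2 have "b = [x] @ b' \<and> fits m [x] \<and> (\<exists>c. coarsening b' c \<and> list_emb (\<le>) c d)"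
        by (auto simp: fits_def)
      then show ?thesis by blast
    next
      case (merge b' r)
      with list_emb_Cons2 have "fits m (replicate r 1)" by (auto simp: fits_def)
      with merge list_emb_Cons2 show ?thesis by blast
    qed
  qed
next
  assume "\<exists>us vs. b = us @ vs \<and> fits m us \<and> (\<exists>c. coarsening vs c \<and> list_emb (\<le>) c d)"
  then obtain us vs c where b: "b = us @ vs" "fits m us" "coarsening vs c" "list_emb (\<le>) c d" by blast
  from b(2) consider "us = []" | x where "us = [x]" "x \<le> m"
    | r where "r \<ge> 1" "us = replicate r 1" "inflate r \<le> m" unfolding fits_def by blast
  then show "\<exists>c. coarsening b c \<and> list_emb (\<le>) c (m # d)"
  proof cases
    case 1
    with b show ?thesis by auto
  next
    case (2 x)
    with b have "coarsening b (x # c)" "list_emb (\<le>) (x # c) (m # d)"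
      by (auto intro: coarsening.keep)
    then show ?thesis by blast
  next
    case (3 r)
    with b have "coarsening b (inflate r # c)" "list_emb (\<le>) (inflate r # c) (m # d)"
      by (auto intro: coarsening.merge simp del: One_nat_def)
    then show ?thesis by blast
  qed
qed

section \<open>The summands of patterns in \<open>\<Omega>\<close>\<close>

definition blocks :: "nat list set" where
  "blocks = {[1]} \<union> {shift_one m | m. m \<ge> 2} \<union> {shift_two m | m. m \<ge> 3}"

lemma blocks_cases [consumes 1, case_names one shift_one shift_two]:
  assumes "\<tau> \<in> blocks"
  obtains "\<tau> = [1]" | m where "m \<ge> 2" "\<tau> = shift_one m" | m where "m \<ge> 3" "\<tau> = shift_two m"
  using assms by (auto simp: blocks_def)

lemma part_of_one [simp]: "part_of [Suc 0] = 1"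
  by (auto simp: part_of_def shift_one_def)

lemma part_of_shift_one [simp]: "m \<ge> 2 \<Longrightarrow> part_of (shift_one m) = m + 1"
  by (auto simp: part_of_def)

lemma part_of_shift_two [simp]:
  assumes "m \<ge> 3"
  shows "part_of (shift_two m) = m"
proof -
  have "last (shift_two m) \<noteq> last (shift_one k)" for k
    by (simp add: shift_one_def shift_two_def)
  then have "shift_two m \<notin> {shift_one m | m. m \<ge> 2}" by force
  then show ?thesis using assms by (simp add: part_of_def)
qed

lemma part_of_eq_1: "\<tau> \<in> blocks \<Longrightarrow> part_of \<tau> = 1 \<longleftrightarrow> \<tau> = [1]"
  by (erule blocks_cases) (auto, auto simp: shift_one_def shift_two_def)

lemma blocks_indecomposable: "\<tau> \<in> blocks \<Longrightarrow> indecomposable \<tau>"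
proof (erule blocks_cases)
  assume "\<tau> = [1]"
  then show ?thesis using shift_one_indecomposable[of 1] by (simp add: shift_one_def)
next
  fix m assume "m \<ge> 3" "\<tau> = shift_two m"
  moreover from this have "last \<tau> \<le> hd \<tau>" by (simp add: shift_two_def upt_conv_Cons del: upt_Suc)
  ultimately show ?thesis using indecomposable_if_last_le_hd[OF shift_two_perms] by simp
qed (simp add: shift_one_indecomposable)

lemma dsums_ones: "dsums (replicate r [1]) = [1..<r + 1]"
proof (induction r)
  case (Suc r)
  then show ?case
    by (simp add: dsum_def map_Suc_upt upt_conv_Cons del: upt_Suc)
qed simp

text \<open>Every block other than \<open>1\<close> has a descent.\<close>

lemma increasing_dsums_blocks:
  assumes "set us \<subseteq> blocks" "sorted_wrt (<) (dsums us)"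
  shows "us = replicate (length (dsums us)) [1]"
  using assms
proof (induction us)
  case (Cons u us)
  then have s: "sorted_wrt (<) u" "sorted_wrt (<) (dsums us)"
    by (auto simp: dsum_def sorted_wrt_append sorted_wrt_map)
  from Cons.prems(1) have "u \<in> blocks" by simp
  then have "u = [1]"
  proof (cases rule: blocks_cases)
    case (shift_one m)
    with s(1) show ?thesis by (auto simp: shift_one_def sorted_wrt_append)
  next
    case (shift_two m)
    with s(1) show ?thesis by (auto simp: shift_two_def sorted_wrt_append)
  qed
  with Cons s(2) show ?case by (simp add: dsum_def)
qed simp

section \<open>Occurrences inside one squared block\<close>

lemma same_order_sorted:
  assumes "same_order xs \<sigma>" "sorted_wrt (<) xs"
  shows "sorted_wrt (<) \<sigma>"
  using assms by (auto simp: same_order_def sorted_wrt_iff_nth_less)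

text \<open>For \<open>r \<ge> 3\<close> the increasing part \<open>3 4 \<dots> m\<close> is long enough, for \<open>r \<le> 2\<close> the tail \<open>1 2\<close> serves.\<close>

lemma square_block_contains_increasing:
  assumes "r \<ge> 1" "inflate r \<le> m"
  shows "perm_contains (square_block m) [1..<r + 1]"
proof -
  consider "r = 1" | "r = 2" "m \<ge> 2" | "r \<ge> 3" "m \<ge> r + 2"
    using assms by (auto simp: inflate_def split: if_splits) linarith
  then show ?thesis
  proof cases
    case 1
    have "subseq [1] (square_block m)"
      by (auto simp: subseq_singleton_left square_block_def shift_two_def)
    with 1 show ?thesis by (auto simp: perm_contains_def same_order_def)
  next
    case 2
    then have "subseq [1, 2] (square_block m)"
      by (auto simp: square_block_def shift_two_def)
    moreover have "[1..<r + 1] = [1, 2]" using 2 by (simp add: upt_rec)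
    ultimately show ?thesis by (auto simp: perm_contains_def same_order_def)
  next
    case 3
    have "subseq [3..<r + 3] [3..<m + 1]"
      using 3 by (intro sorted_subset_imp_subseq) (auto simp del: upt_Suc)
    then have "subseq [3..<r + 3] (square_block m)"
      using 3 by (auto simp: square_block_def shift_two_def simp del: upt_Suc)
    moreover have "same_order [3..<r + 3] [1..<r + 1]"
      by (simp add: same_order_def del: upt_Suc)
    ultimately show ?thesis unfolding perm_contains_def by blast
  qed
qed

text \<open>The block \<open>2 3 \<dots> k 1\<close> uses only one of the two small entries of \<open>3 4 \<dots> m 1 2\<close>; this is why
  its part is one more than its length. The block \<open>3 4 \<dots> k 1 2\<close> uses both.\<close>

lemma square_block_contains_block:
  assumes "\<tau> \<in> blocks" "part_of \<tau> \<le> m"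
  shows "perm_contains (square_block m) \<tau>"
  using assms(1)
proof (cases rule: blocks_cases)
  case one
  with assms square_block_contains_increasing[of 1 m] show ?thesis
    by (simp add: inflate_def)
next
  case (shift_one k)
  with assms have m: "k + 1 \<le> m" by simp
  have "subseq [3..<k + 2] [3..<m + 1]"
    using m by (intro sorted_subset_imp_subseq) (auto simp del: upt_Suc)
  moreover have "subseq [1] [1, 2::nat]" by simp
  ultimately have "subseq ([3..<k + 2] @ [1]) (square_block m)"
    using m shift_one(1) unfolding square_block_def shift_two_def
    by (simp del: upt_Suc add: list_emb_append_mono)
  moreover have "same_order ([3..<k + 2] @ [1]) \<tau>"
    using shift_one by (auto simp: same_order_def shift_one_def nth_append simp del: upt_Suc)
  ultimately show ?thesis unfolding perm_contains_def by blast
next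
  case (shift_two k)
  with assms have m: "k \<le> m" by simp
  have "subseq [3..<k + 1] [3..<m + 1]"
    using m by (intro sorted_subset_imp_subseq) (auto simp del: upt_Suc)
  then have "subseq \<tau> (square_block m)"
    using m shift_two by (simp add: square_block_def shift_two_def del: upt_Suc)
  moreover have "same_order \<tau> \<tau>" by (simp add: same_order_def)
  ultimately show ?thesis unfolding perm_contains_def by blast
qed

text \<open>An occurrence inside \<open>3 4 \<dots> m 1 2\<close> consists of entries from the increasing top \<open>3 4 \<dots> m\<close> and
  entries from the tail \<open>1 2\<close>. If it uses only one of the two, the pattern is increasing, so its
  summands are all \<open>1\<close>. If it uses both, its first entry exceeds its last, so the pattern is
  indecomposable and consists of a single summand; counting entries then bounds the part of that
  summand.\<close>

lemma fits_if_square_block_contains: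
  assumes m: "m \<ge> 1" and us: "set us \<subseteq> blocks"
    and con: "perm_contains (square_block m) (dsums us)"
  shows "fits m (map part_of us)"
proof -
  let ?\<sigma> = "dsums us"
  from con obtain xs where xs: "subseq xs (square_block m)" "same_order xs ?\<sigma>"
    by (auto simp: perm_contains_def)
  have len: "length xs = length ?\<sigma>" using xs(2) by (simp add: same_order_def)
  have sorted_case: "fits m (map part_of us)" if "sorted_wrt (<) xs" "inflate (length xs) \<le> m"
  proof -
    have "us = replicate (length xs) [1]"
      using increasing_dsums_blocks[OF us same_order_sorted[OF xs(2) that(1)]] len by simp
    then have "map part_of us = replicate (length xs) 1"
      by (subst \<open>us = _\<close>) simp
    with that(2) show ?thesis by (cases "length xs") (auto simp: fits_def)
  qed
  show ?thesis
  proof (cases "m = 1")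
    case True
    then have "length xs \<le> 1" using list_emb_length[OF xs(1)] by (simp add: square_block_def)
    then show ?thesis
      using True by (intro sorted_case) (auto simp: sorted_wrt_iff_nth_less inflate_def)
  next
    case False
    with xs(1) obtain xa xb where x: "xs = xa @ xb" "subseq xa [3..<m + 1]" "subseq xb [1, 2]"
      by (auto simp: square_block_def shift_two_def subseq_append_iff simp del: upt_Suc)
    have la: "length xa \<le> m - 2" and lb: "length xb \<le> 2"
      using list_emb_length[OF x(2)] list_emb_length[OF x(3)] False m by (simp_all del: upt_Suc)
    have sa: "sorted_wrt (<) xa" and sb: "sorted_wrt (<) xb"
      using subseq_sorted_wrt[OF x(2) sorted_wrt_upt] subseq_sorted_wrt[OF x(3)] by simp_all
    consider "xa = []" | "xb = []" | "xa \<noteq> []" "xb \<noteq> []" by blast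
    then show ?thesis
    proof cases
      case 1
      then show ?thesis using x(1) sb lb False m by (intro sorted_case) (auto simp: inflate_def)
    next
      case 2
      then show ?thesis using x(1) sa la False m by (intro sorted_case) (auto simp: inflate_def)
    next
      case 3
      have ind: "\<forall>\<tau>\<in>set us. indecomposable \<tau>" using us blocks_indecomposable by blast
      then have p: "?\<sigma> \<in> perms (length ?\<sigma>)"
        using dsums_perms[of us] indecomposable_perms length_perms by metis
      have ne: "xs \<noteq> []" "?\<sigma> \<noteq> []" using 3 x(1) len by auto
      have "hd xa \<in> set [3..<m + 1]" "last xb \<in> set [1, 2::nat]"
        using 3 x(2,3) unfolding subseq_conv_nths
        by (metis hd_in_set in_set_nthsD, metis last_in_set in_set_nthsD)
      then have "\<not> hd xs < last xs" using 3 x(1) by (auto simp del: upt_Suc)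
      then have "last ?\<sigma> \<le> hd ?\<sigma>"
        using xs(2) ne len unfolding same_order_def by (auto simp: hd_conv_nth last_conv_nth)
      then have "indecomposable ?\<sigma>"
        using ne(2) by (intro indecomposable_if_last_le_hd[OF p]) (simp_all add: Suc_le_eq)
      then have us1: "us = [?\<sigma>]"
        by (intro dsums_unique ind) (auto simp: dsum_def)
      then have "?\<sigma> \<in> set us" by (metis list.set_intros(1))
      then have "?\<sigma> \<in> blocks" using us by blast
      then have "part_of ?\<sigma> \<le> m"
      proof (cases rule: blocks_cases)
        case one
        then show ?thesis using m by simp
      next
        case (shift_one k)
        \<comment> \<open>Two tail entries would end the occurrence in an ascent, but \<open>2 3 \<dots> k 1\<close> ends in a descent.\<close>
        have "length xb \<noteq> 2"
        proof
          assume "length xb = 2"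
          then have xb: "xb = [1, 2]" using subseq_same_length[OF x(3)] by simp
          have "length xa = length [2..<k]"
            using len x(1) xb shift_one by (simp del: upt_Suc)
          moreover have "?\<sigma> = [2..<k] @ [k] @ [] @ [1] @ []"
            using shift_one by (simp add: shift_one_def)
          moreover have "xs = xa @ [1] @ [] @ [2] @ []" using x(1) xb by simp
          ultimately have "(1::nat) < 2 \<longleftrightarrow> k < 1"
            using xs(2) by (intro same_order_less[where us = xa and vs = "[]" and ws = "[]"
                and us' = "[2..<k]" and vs' = "[]" and ws' = "[]"]) simp_all
          with shift_one(1) show False by simp
        qed
        with la lb len x(1) shift_one False m show ?thesis by simp
      next
        case (shift_two k)
        with la lb len x(1) False m show ?thesis by simp
      qed
      then have "fits m [part_of ?\<sigma>]" by (simp add: fits_def)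
      also have "[part_of ?\<sigma>] = map part_of us" by (subst (2) us1) simp
      finally show ?thesis .
    qed
  qed
qed

lemma square_block_contains_iff_fits:
  assumes m: "m \<ge> 1" and us: "set us \<subseteq> blocks"
  shows "perm_contains (square_block m) (dsums us) \<longleftrightarrow> fits m (map part_of us)"
proof
  assume "fits m (map part_of us)"
  then consider "us = []" | \<tau> where "us = [\<tau>]" "part_of \<tau> \<le> m"
    | r where "r \<ge> 1" "map part_of us = replicate r 1" "inflate r \<le> m"
    unfolding fits_def by auto
  then show "perm_contains (square_block m) (dsums us)"
  proof cases
    case (2 \<tau>)
    with us show ?thesis using square_block_contains_block[of \<tau> m] by (simp add: dsum_def)
  next
    case (3 r)
    have "\<tau> = [1]" if "\<tau> \<in> set us" for \<tau>
    proof -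
      have "part_of \<tau> \<in> set (map part_of us)" using that by simp
      then have "part_of \<tau> = 1" unfolding 3(2) by simp
      with that us show ?thesis using part_of_eq_1 by blast
    qed
    then have "us = replicate (length us) [1]"
      by (metis replicate_length_same)
    moreover have "length us = r" using 3(2) by (metis length_map length_replicate)
    ultimately show ?thesis
      using square_block_contains_increasing[OF 3(1,3)] dsums_ones[of r] by simp
  qed simp
qed (rule fits_if_square_block_contains[OF assms])

section \<open>Counting\<close>

text \<open>Both sides obey the same recursion on \<open>d\<close>: the first part \<open>m\<close> absorbs an initial segment of the
  summands of the pattern that fits into it, and the rest is left to the remaining parts.\<close>

lemma square_contains_iff:
  assumes "\<forall>m\<in>set d. m \<ge> 1" "set us \<subseteq> blocks"
  shows "perm_contains (dsums (map square_block d)) (dsums us) \<longleftrightarrow>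
    (\<exists>c. coarsening (map part_of us) c \<and> list_emb (\<le>) c d)"
  using assms
proof (induction d arbitrary: us)
  case Nil
  have "dsums us = [] \<longleftrightarrow> us = []"
    using Nil.prems(2) blocks_indecomposable indecomposable_nonempty
    by (cases us) (auto simp: dsum_def)
  then show ?case by (auto dest: list_emb_Nil2)
next
  case (Cons m d)
  have ind: "\<forall>\<tau>\<in>set us. indecomposable \<tau>" using Cons.prems(2) blocks_indecomposable by blast
  have md: "m \<ge> 1" "\<forall>m\<in>set d. m \<ge> 1" using Cons.prems(1) by auto
  have "perm_contains (dsums (map square_block (m # d))) (dsums us) \<longleftrightarrow>
    (\<exists>vs ws. us = vs @ ws \<and> perm_contains (square_block m) (dsums vs) \<and>
       perm_contains (dsums (map square_block d)) (dsums ws))"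
    using perm_contains_dsum_dsums[OF square_block_perms[OF md(1)]
        dsums_blocks_perms[OF md(2) square_block_perms] ind] by simp
  also have "\<dots> \<longleftrightarrow> (\<exists>vs ws. us = vs @ ws \<and> fits m (map part_of vs) \<and>
       (\<exists>c. coarsening (map part_of ws) c \<and> list_emb (\<le>) c d))"
    using Cons.IH[OF md(2)] square_block_contains_iff_fits[OF md(1)] Cons.prems(2)
    by (intro iff_exI conj_cong refl) auto
  also have "\<dots> \<longleftrightarrow> (\<exists>b b'. map part_of us = b @ b' \<and> fits m b \<and>
       (\<exists>c. coarsening b' c \<and> list_emb (\<le>) c d))"
    by (auto simp: map_eq_append_conv)
  finally show ?case by (simp only: coarsening_emb_Cons)
qed

theorem theorem3p5:
  fixes n :: nat and \<sigma> :: "nat list"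
  assumes "n \<ge> 1" and "\<sigma> \<in> Omega"
  shows "card {\<pi> \<in> perms n. avoids_chain_312_321 \<pi> \<sigma>} =
         card {d \<in> compositions n. comp_avoids_set d (C_set \<sigma>)}"
proof -
  let ?f = "\<lambda>d. dsums (map shift_one d)"
  let ?us = "decomposition \<sigma>"
  from assms(2) obtain k where "\<sigma> \<in> perms k" and us: "set ?us \<subseteq> blocks"
    by (auto simp: Omega_def Omega_n_def blocks_def)
  then have \<sigma>: "dsums ?us = \<sigma>" by (intro decomposition)
  have iff: "perm_avoids (perm_comp (?f d) (?f d)) \<sigma> \<longleftrightarrow> comp_avoids_set d (C_set \<sigma>)"
    if "d \<in> compositions n" for d
  proof -
    have d: "\<forall>m\<in>set d. m \<ge> 1" using that by (auto simp: compositions_def Suc_le_eq)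
    show ?thesis
      using square_contains_iff[OF d us] square_dsums_shift_one[OF d]
      by (simp add: \<sigma> comp_avoids_set_def C_set_def base_comp_def
          comp_contains_iff_list_emb replace_runs_iff_coarsening Ball_def)
  qed
  let ?A = "{\<pi> \<in> perms n. perm_avoids \<pi> [3, 1, 2] \<and> perm_avoids \<pi> [3, 2, 1]}"
  have inj: "inj_on ?f (compositions n)" and img: "?f ` compositions n = ?A"
    using bij_betw_dsums_shift_one by (auto simp: bij_betw_def)
  have "{\<pi> \<in> perms n. avoids_chain_312_321 \<pi> \<sigma>} =
      {\<pi> \<in> ?f ` compositions n. perm_avoids (perm_comp \<pi> \<pi>) \<sigma>}"
    unfolding img avoids_chain_312_321_def by blast
  also have "\<dots> = ?f ` {d \<in> compositions n. comp_avoids_set d (C_set \<sigma>)}"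
    using iff by auto
  finally show ?thesis
    using inj by (simp add: card_image inj_on_subset[OF inj])
qed

end
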